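(* Let $S_n$ denote the symmetric group on $[n]=\{1,\dots,n\}$, viewed as a lattice under the right weak order. Then the number of Eeta wins in $S_n$ satisfies $|\mathbf{E}(S_n)| = O(0.95586^n\, n!)$ as $n\to\infty$.
   Context: An inversion of $w\in S_n$ is a pair $(i,j)$ with $1\le i<j\le n$ and $w^{-1}(i)>w^{-1}(j)$. The (right) weak order on $S_n$ is defined by $u\le v$ iff every inversion of $u$ is an inversion of $v$; it is a lattice. For a meet-semilattice $L$ (every principal order ideal finite, so $L$ has a minimum $\hat 0$) and $x\in L$, let $\mathrm{cov}_L(x)$ be the set of elements covered by $x$. An Ungar move sends $x$ to $\bigwedge(\{x\}\cup T)$ for some $T\subseteq \mathrm{cov}_L(x)$; it is nontrivial if $T\neq\emptyset$. Let $\mathrm{Ung}(x)$ be the set of elements obtainable from $x$ by one Ungar move. The Ungar game on a finite lattice $L$: starting at the top element $\hat 1$, two players, Atniss (moving first) and Eeta, alternately make nontrivial Ungar moves; the first player unable to do so (i.e. facing $\hat 0$) loses. $L$ is an Atniss win if Atniss has a winning strategy, and an Eeta win otherwise. An element $x\in L$ is an Eeta win (resp. Atniss win) in $L$ if the interval $[\hat 0,x]$ is an Eeta win (resp. Atniss win); equivalently, recursively, $\hat 0$ is an Eeta win, and $x$ is an Atniss win iff some element of $\mathrm{Ung}(x)\setminus\{x\}$ is an Eeta win. $\mathbf{E}(L)$ denotes the set of Eeta wins in $L$. *)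

theory Defs
  imports
    Complex_Main
    "HOL-Algebra.Lattice"
    "HOL-Combinatorics.Permutations"
    "HOL-Library.Landau_Symbols"
begin

definition inversions :: "nat \<Rightarrow> (nat \<Rightarrow> nat) \<Rightarrow> (nat \<times> nat) set" where
  "inversions n w = {(i, j). 1 \<le> i \<and> i < j \<and> j \<le> n \<and> inv w i > inv w j}"

definition right_weak_order :: "nat \<Rightarrow> (nat \<Rightarrow> nat) gorder" where
  "right_weak_order n =
     \<lparr>carrier = {w. w permutes {1..n}}, eq = (=),
      le = (\<lambda>u v. inversions n u \<subseteq> inversions n v)\<rparr>"

definition covered_by :: "('a, 'b) gorder_scheme \<Rightarrow> 'a \<Rightarrow> 'a set" where
  "covered_by L x =
     {y \<in> carrier L. y \<sqsubset>\<^bsub>L\<^esub> x \<and> \<not> (\<exists>z\<in>carrier L. y \<sqsubset>\<^bsub>L\<^esub> z \<and> z \<sqsubset>\<^bsub>L\<^esub> x)}"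

definition nontrivial_ungar_moves :: "('a, 'b) gorder_scheme \<Rightarrow> 'a \<Rightarrow> 'a set" where
  "nontrivial_ungar_moves L x =
     {\<Sqinter>\<^bsub>L\<^esub>({x} \<union> T) | T. T \<subseteq> covered_by L x \<and> T \<noteq> {}}"

text \<open>
  A strategy \<open>\<sigma>\<close> for Atniss maps the history of the game (most recent element first) to
  the element she moves to. \<open>atniss_turns L \<sigma>\<close> is the set of histories, at the points where
  it is her turn, of the plays in which she follows \<open>\<sigma>\<close>.
\<close>

inductive_set atniss_turns ::
    "('a, 'b) gorder_scheme \<Rightarrow> ('a list \<Rightarrow> 'a) \<Rightarrow> 'a list set"
  for L :: "('a, 'b) gorder_scheme" and \<sigma> :: "'a list \<Rightarrow> 'a"
where
  start: "[\<top>\<^bsub>L\<^esub>] \<in> atniss_turns L \<sigma>"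
| round: "\<lbrakk>h \<in> atniss_turns L \<sigma>; \<sigma> h \<in> nontrivial_ungar_moves L (hd h);
            y \<in> nontrivial_ungar_moves L (\<sigma> h)\<rbrakk>
          \<Longrightarrow> y # \<sigma> h # h \<in> atniss_turns L \<sigma>"

text \<open>
  Nontrivial Ungar moves go strictly down, so on a finite lattice every play ends with one
  player unable to move; hence a strategy wins for Atniss iff it supplies a legal move
  whenever it is her turn.
\<close>

definition atniss_win :: "('a, 'b) gorder_scheme \<Rightarrow> bool" where
  "atniss_win L \<longleftrightarrow>
     (\<exists>\<sigma>. \<forall>h\<in>atniss_turns L \<sigma>. \<sigma> h \<in> nontrivial_ungar_moves L (hd h))"

definition eeta_win :: "('a, 'b) gorder_scheme \<Rightarrow> bool" where
  "eeta_win L \<longleftrightarrow> \<not> atniss_win L"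

definition eeta_wins :: "('a, 'b) gorder_scheme \<Rightarrow> 'a set" where
  "eeta_wins L =
     {x \<in> carrier L. eeta_win (L\<lparr>carrier := \<lbrace>\<bottom>\<^bsub>L\<^esub>..x\<rbrace>\<^bsub>L\<^esub>\<rparr>)}"

end

theory Submission
  imports Defs "HOL-Library.Infinite_Set"
begin

text \<open>
  Suppose the one-line notation of \<open>x\<close> contains a descending run with at least two letters, all of
  which are larger than the letter before and smaller than the letter after the run. Let \<open>y\<close> be
  obtained by reversing the run. No new descents arise, so every nontrivial Ungar move from \<open>y\<close>
  can also be made directly from \<open>x\<close>, and by strategy stealing \<open>x\<close> is an Atniss win. Hence Eeta wins
  avoid the consecutive patterns 1324 and 14325.

  Let \<open>a n\<close> be the proportion of permutations avoiding both. Since \<open>a (n - 1) - a n\<close> is the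
  proportion of words whose only hit is at the front, bounding it above by the union bound
  yields \<open>a n \<ge> 0.937 a (n - 1)\<close>, and subtracting the words with overlapping hits bounds it below by
  a linear combination of \<open>a (n - 4)\<close>, ..., \<open>a (n - 8)\<close>. Feeding an upper bound for the ratios
  \<open>a n / a (n - 1)\<close> back into this inequality improves it, and three rounds
  \<open>1\<close>, \<open>0.963\<close>, \<open>0.9565\<close>, \<open>0.95586\<close> suffice.
\<close>

section \<open>Strategy stealing\<close>

text \<open>
  Positions that the player to move loses in finitely many rounds. As this is a least fixed point,
  termination of the game is never needed.
\<close>

inductive lost :: "('a \<Rightarrow> 'a set) \<Rightarrow> 'a \<Rightarrow> bool" for N :: "'a \<Rightarrow> 'a set" where
  lostI: "\<forall>m\<in>N z. \<exists>z'\<in>N m. lost N z' \<Longrightarrow> lost N z"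

text \<open>From a lost \<open>z\<close>, a move to \<open>m\<close> has a lost reply
  \<open>z'\<close>. If \<open>m\<close> were lost too, then \<open>z'\<close>, being a move from
  \<open>m\<close>, would itself admit a lost reply, against the induction hypothesis at
  \<open>z'\<close>.\<close>

lemma lost_not_reachable_from_lost:
  assumes "lost N z" "m \<in> N z"
  shows "\<not> lost N m"
  using assms
proof (induction arbitrary: m rule: lost.induct)
  case (lostI z)
  then obtain z' where "z' \<in> N m" "\<And>m'. m' \<in> N z' \<Longrightarrow> \<not> lost N m'" by blast
  then show ?case by (metis lost.cases)
qed

text \<open>Being lost passes to positions with fewer moves: if \<open>x\<close> were lost, so would
  be \<open>y\<close>, yet no move joins two lost positions.\<close>

lemma strategy_stealing:
  assumes "y \<in> N x" "N y \<subseteq> N x"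
  shows "\<not> lost N x"
  by (metis assms lost.cases lost_not_reachable_from_lost subsetD)

text \<open>A positional strategy suffices: from a position that is not lost, choose a move after
  which no reply is lost. The invariant supplies Atniss with a legal move at each of her
  turns.\<close>

lemma atniss_win_if_not_lost:
  assumes "\<not> lost (nontrivial_ungar_moves L) \<top>\<^bsub>L\<^esub>"
  shows "atniss_win L"
proof -
  define N where "N = nontrivial_ungar_moves L"
  define \<sigma> where "\<sigma> h = (SOME m. m \<in> N (hd h) \<and> (\<forall>z\<in>N m. \<not> lost N z))" for h
  have \<sigma>: "\<sigma> h \<in> N (hd h) \<and> (\<forall>z\<in>N (\<sigma> h). \<not> lost N z)" if "\<not> lost N (hd h)" for h
  proof -
    have "\<exists>m. m \<in> N (hd h) \<and> (\<forall>z\<in>N m. \<not> lost N z)"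
      using that lost.intros[of N "hd h"] by blast
    then show ?thesis unfolding \<sigma>_def by (rule someI_ex)
  qed
  have "\<not> lost N (hd h)" if "h \<in> atniss_turns L \<sigma>" for h
    using that
  proof induction
    case start
    then show ?case using assms by (simp add: N_def)
  next
    case (round h y)
    then show ?case using \<sigma>[of h] by (simp add: N_def)
  qed
  then show ?thesis
    unfolding atniss_win_def using \<sigma> N_def by blast
qed

section \<open>The weak order\<close>

text \<open>Composed on the right it acts on positions. The case \<open>l = Suc k\<close> is an
  adjacent transposition, so one definition serves both the reversal of a run and the covers of the
  weak order.\<close>

definition reverse_block :: "nat \<Rightarrow> nat \<Rightarrow> nat \<Rightarrow> nat" where
  "reverse_block k l p = (if k \<le> p \<and> p \<le> l then k + l - p else p)"

lemma reverse_block_involution [simp]: "reverse_block k l (reverse_block k l p) = p"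
  by (auto simp: reverse_block_def)

lemma reverse_block_permutes:
  assumes "1 \<le> k" "l \<le> n"
  shows "reverse_block k l permutes {1..n}"
proof (rule bij_imp_permutes)
  show "bij_betw (reverse_block k l) {1..n} {1..n}"
    by (rule bij_betw_byWitness[where f' = "reverse_block k l"])
      (use assms in \<open>auto simp: reverse_block_def\<close>)
qed (use assms in \<open>auto simp: reverse_block_def\<close>)

lemma inv_comp_reverse_block:
  assumes "x permutes {1..n}"
  shows "inv (x \<circ> reverse_block k l) i = reverse_block k l (inv x i)"
proof -
  have "bij (reverse_block k l)" by (rule involuntory_imp_bij) simp
  moreover have "inv (reverse_block k l) = reverse_block k l"
    by (rule inv_unique_comp) (auto simp: fun_eq_iff)
  ultimately show ?thesis
    using o_inv_distrib[of x "reverse_block k l"] permutes_bij[OF assms] by simp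
qed

text \<open>The block is preserved as a set, so only pairs with both letters in it change relative
  order; by \<open>decr\<close> all of these are inverted before and none after.\<close>

lemma inversions_comp_reverse_block:
  assumes x: "x permutes {1..n}"
    and decr: "\<And>p q. k \<le> p \<Longrightarrow> p < q \<Longrightarrow> q \<le> l \<Longrightarrow> x q < x p"
  shows "inversions n (x \<circ> reverse_block k l) =
    inversions n x - {(i, j). inv x i \<in> {k..l} \<and> inv x j \<in> {k..l}}"
proof -
  have "reverse_block k l (inv x i) > reverse_block k l (inv x j) \<longleftrightarrow>
      inv x i > inv x j \<and> \<not> (inv x i \<in> {k..l} \<and> inv x j \<in> {k..l})" if "i < j" for i j
  proof (cases "inv x i \<in> {k..l} \<and> inv x j \<in> {k..l}")
    case True
    then have "inv x i \<ge> inv x j"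
      using decr[of "inv x i" "inv x j"] that permutes_inverses(1)[OF x]
      by (metis atLeastAtMost_iff not_less less_asym)
    then show ?thesis using True by (auto simp: reverse_block_def)
  next
    case False
    then show ?thesis by (auto simp: reverse_block_def)
  qed
  then show ?thesis
    unfolding inversions_def inv_comp_reverse_block[OF x] by auto
qed

lemma permutes_eq_if_inv_increasing:
  assumes u: "u permutes {1..n}" and v: "v permutes {1..n}"
    and step: "\<And>p. 1 \<le> p \<Longrightarrow> p < n \<Longrightarrow> inv u (v p) < inv u (v (Suc p))"
  shows "u = v"
proof -
  have perm: "(inv u \<circ> v) permutes {1..n}"
    using u v by (intro permutes_compose permutes_inv)
  have le: "p \<le> (inv u \<circ> v) p" if "p \<in> {1..n}" for p
  proof -
    have "1 \<le> p \<Longrightarrow> p \<le> n \<Longrightarrow> p \<le> (inv u \<circ> v) p"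
    proof (induction p rule: nat_induct_at_least[of 1])
      case base
      then show ?case using permutes_in_image[OF perm, of 1] by auto
    next
      case (Suc p)
      then show ?case using step[of p] by auto
    qed
    with that show ?thesis by auto
  qed
  have "inv u \<circ> v = id"
    by (rule permutes_natset_ge[OF perm]) (use le in auto)
  then have "u \<circ> (inv u \<circ> v) = u" by simp
  then show ?thesis
    using permutes_inv_o(1)[OF u] by (metis comp_assoc id_comp)
qed

text \<open>Where \<open>inv u \<circ> v\<close> fails to increase, \<open>u\<close> and
  \<open>v\<close> order the letters \<open>v p\<close> and \<open>v (Suc p)\<close> oppositely.
  They form a descent of \<open>v\<close>, since an ascent would give an inversion of
  \<open>u\<close> that \<open>v\<close> lacks.\<close>

lemma ex_descent_not_inversion:
  assumes u: "u permutes {1..n}" and v: "v permutes {1..n}"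
    and sub: "inversions n u \<subseteq> inversions n v" and neq: "u \<noteq> v"
  obtains p where "1 \<le> p" "p < n" "v (Suc p) < v p" "(v (Suc p), v p) \<notin> inversions n u"
proof -
  obtain p where p: "1 \<le> p" "p < n" "\<not> inv u (v p) < inv u (v (Suc p))"
    using permutes_eq_if_inv_increasing[OF u v] neq by blast
  have in_range: "v p \<in> {1..n}" "v (Suc p) \<in> {1..n}"
    using p permutes_in_image[OF v] by auto
  have ne: "v p \<noteq> v (Suc p)" using permutes_inj[OF v] by (metis injD n_not_Suc_n)
  then have "inv u (v p) \<noteq> inv u (v (Suc p))"
    using permutes_inverses(1)[OF u] by metis
  then have gt: "inv u (v p) > inv u (v (Suc p))" using p by simp
  have "\<not> v p < v (Suc p)"
  proof
    assume "v p < v (Suc p)"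
    then have "(v p, v (Suc p)) \<in> inversions n u"
      using gt in_range by (auto simp: inversions_def)
    then have "(v p, v (Suc p)) \<in> inversions n v" using sub by blast
    then show False using permutes_inverses(2)[OF v] by (auto simp: inversions_def)
  qed
  then show thesis using that[of p] p ne gt by (auto simp: inversions_def)
qed

lemma inversions_inject:
  assumes u: "u permutes {1..n}" and v: "v permutes {1..n}"
    and eq: "inversions n u = inversions n v"
  shows "u = v"
proof (rule ccontr)
  assume "u \<noteq> v"
  then obtain p where p: "1 \<le> p" "p < n" "v (Suc p) < v p" "(v (Suc p), v p) \<notin> inversions n v"
    using ex_descent_not_inversion[OF u v] eq by blast
  then show False
    using permutes_in_image[OF v, of p] permutes_in_image[OF v, of "Suc p"] permutes_inverses(2)[OF v]
    by (auto simp: inversions_def)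
qed

section \<open>Lower intervals and their covers\<close>

definition weak_ideal :: "nat \<Rightarrow> (nat \<Rightarrow> nat) \<Rightarrow> (nat \<Rightarrow> nat) gorder" where
  "weak_ideal n x = \<lparr>carrier = {w. w permutes {1..n} \<and> inversions n w \<subseteq> inversions n x}, eq = (=),
      le = (\<lambda>u v. inversions n u \<subseteq> inversions n v)\<rparr>"

lemma weak_ideal_simps [simp]:
  "carrier (weak_ideal n x) = {w. w permutes {1..n} \<and> inversions n w \<subseteq> inversions n x}"
  "eq (weak_ideal n x) = (=)"
  "le (weak_ideal n x) = (\<lambda>u v. inversions n u \<subseteq> inversions n v)"
  by (simp_all add: weak_ideal_def)

lemma interval_right_weak_order:
  "right_weak_order n \<lparr>carrier := \<lbrace>\<bottom>\<^bsub>right_weak_order n\<^esub>..x\<rbrace>\<^bsub>right_weak_order n\<^esub>\<rparr> = weak_ideal n x"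
proof -
  let ?L = "right_weak_order n"
  have "least ?L id (carrier ?L)"
    by (auto simp: least_def right_weak_order_def inversions_def permutes_id)
  \<comment> \<open>The bottom is a choice among least elements; \<open>id\<close> shows that one
    exists, and only minimality is needed afterwards.\<close>
  then have "least ?L \<bottom>\<^bsub>?L\<^esub> (carrier ?L)"
    unfolding bottom_def by (rule someI[where P = "\<lambda>b. least ?L b (carrier ?L)"])
  then have "\<bottom>\<^bsub>?L\<^esub> \<sqsubseteq>\<^bsub>?L\<^esub> w" if "w \<in> carrier ?L" for w
    using that by (auto simp: least_def)
  then show ?thesis
    by (auto simp: right_weak_order_def weak_ideal_def at_least_at_most_def)
qed

text \<open>Tops and meets are defined by choice, so computing them requires this
  uniqueness.\<close>

lemma weak_ideal_greatest_unique:
  assumes "greatest (weak_ideal n x) u A" "greatest (weak_ideal n x) v A"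
  shows "u = v"
  using assms by (intro inversions_inject[of u n v]) (auto simp: greatest_def)

lemma weak_ideal_top:
  assumes "x permutes {1..n}"
  shows "\<top>\<^bsub>weak_ideal n x\<^esub> = x"
proof -
  let ?L = "weak_ideal n x"
  have g: "greatest ?L x (carrier ?L)" using assms by (auto simp: greatest_def)
  show ?thesis unfolding top_def
    by (rule some_equality) (fact g, rule weak_ideal_greatest_unique[OF _ g])
qed

lemma inversions_comp_adjacent:
  assumes v: "v permutes {1..n}" and p: "1 \<le> p" "p < n" "v (Suc p) < v p"
  shows "inversions n (v \<circ> reverse_block p (Suc p)) = inversions n v - {(v (Suc p), v p)}"
    and "(v (Suc p), v p) \<in> inversions n v"
proof -
  have iv: "inv v i = q \<longleftrightarrow> i = v q" for i q
    using permutes_inverses[OF v] by metis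
  have "{p..Suc p} = {p, Suc p}" by auto
  moreover have "inversions n (v \<circ> reverse_block p (Suc p)) =
    inversions n v - {(i, j). inv v i \<in> {p..Suc p} \<and> inv v j \<in> {p..Suc p}}"
  proof (rule inversions_comp_reverse_block[OF v])
    fix a b assume "p \<le> a" "a < b" "b \<le> Suc p"
    then have "a = p" "b = Suc p" by auto
    then show "v b < v a" using p by simp
  qed
  ultimately show "inversions n (v \<circ> reverse_block p (Suc p)) = inversions n v - {(v (Suc p), v p)}"
    using p(3) by (auto simp: iv inversions_def)
  show "(v (Suc p), v p) \<in> inversions n v"
    using p permutes_in_image[OF v, of p] permutes_in_image[OF v, of "Suc p"] permutes_inverses(2)[OF v]
    by (auto simp: inversions_def)
qed

text \<open>Anything strictly below \<open>v\<close> lies below the swap of \<open>v\<close> at a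
  descent given by \<open>ex_descent_not_inversion\<close>, so a covered element is such a swap.
  Conversely a swap at a descent loses a single inversion, which leaves no room in between.\<close>

lemma covered_by_weak_ideal:
  assumes v: "v \<in> carrier (weak_ideal n x)"
  shows "covered_by (weak_ideal n x) v =
    {v \<circ> reverse_block p (Suc p) | p. 1 \<le> p \<and> p < n \<and> v (Suc p) < v p}"
proof (intro equalityI subsetI)
  let ?L = "weak_ideal n x"
  have v': "v permutes {1..n}" using v by simp
  have perm: "v \<circ> reverse_block p (Suc p) permutes {1..n}" if "1 \<le> p" "p < n" for p
    using that v' by (intro permutes_compose reverse_block_permutes) auto
  {
    fix z assume z: "z \<in> covered_by ?L v"
    then have zp: "z permutes {1..n}" "inversions n z \<subseteq> inversions n v" "z \<noteq> v"
      by (auto simp: covered_by_def lless_def)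
    obtain p where p: "1 \<le> p" "p < n" "v (Suc p) < v p" "(v (Suc p), v p) \<notin> inversions n z"
      using ex_descent_not_inversion[OF zp(1) v' zp(2,3)] .
    let ?y = "v \<circ> reverse_block p (Suc p)"
    note inv_y = inversions_comp_adjacent[OF v' p(1-3)]
    have "?y \<noteq> v" using inv_y by (metis Diff_iff singletonI)
    moreover have "?y \<in> carrier ?L" using inv_y(1) perm[OF p(1,2)] v by auto
    moreover have "inversions n z \<subseteq> inversions n ?y" using inv_y(1) zp p by blast
    moreover have "inversions n ?y \<subseteq> inversions n v" using inv_y(1) by blast
    moreover have "\<not> (inversions n z \<subseteq> inversions n u \<and> z \<noteq> u \<and>
        inversions n u \<subseteq> inversions n v \<and> u \<noteq> v)" if "u \<in> carrier ?L" for u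
      using z that by (auto simp: covered_by_def lless_def)
    ultimately have "z = ?y" by blast
    then show "z \<in> {v \<circ> reverse_block p (Suc p) | p. 1 \<le> p \<and> p < n \<and> v (Suc p) < v p}"
      using p by blast
  next
    fix z assume "z \<in> {v \<circ> reverse_block p (Suc p) | p. 1 \<le> p \<and> p < n \<and> v (Suc p) < v p}"
    then obtain p where p: "1 \<le> p" "p < n" "v (Suc p) < v p"
      and z: "z = v \<circ> reverse_block p (Suc p)" by blast
    note inv_z = inversions_comp_adjacent[OF v' p, folded z]
    have zp: "z permutes {1..n}" using perm[OF p(1,2)] z by simp
    have "\<not> (inversions n z \<subseteq> inversions n u \<and> z \<noteq> u \<and> inversions n u \<subseteq> inversions n v \<and> u \<noteq> v)"
      if u: "u permutes {1..n}" for u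
    proof
      assume a: "inversions n z \<subseteq> inversions n u \<and> z \<noteq> u \<and> inversions n u \<subseteq> inversions n v \<and> u \<noteq> v"
      then have "inversions n u = inversions n v \<or> inversions n u = inversions n z"
        using inv_z by auto
      then show False using a inversions_inject[OF u v'] inversions_inject[OF u zp] by auto
    qed
    moreover have "z \<noteq> v" using inv_z by (metis Diff_iff singletonI)
    moreover have "inversions n z \<subseteq> inversions n v" using inv_z(1) by blast
    ultimately show "z \<in> covered_by ?L v"
      using zp v by (auto simp: covered_by_def lless_def)
  }
qed

section \<open>Reversing a descending run\<close>

text \<open>With \<open>R\<close> the swaps inside the run, \<open>y\<close> is the meet of
  \<open>x\<close> and \<open>R\<close>, and a move from \<open>y\<close> by swaps at the positions
  in \<open>D\<close> equals the move from \<open>x\<close> by \<open>R\<close> together with the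
  swaps at \<open>D\<close>. Meets need not be intersections of inversion sets, so both facts are
  proved by comparing lower bounds.\<close>

lemma run_between_imp_atniss_win:
  assumes x: "x permutes {1..n}" and k: "1 < k" "k < l" "l < n"
    and decr: "\<And>p q. k \<le> p \<Longrightarrow> p < q \<Longrightarrow> q \<le> l \<Longrightarrow> x q < x p"
    and low: "x (k - 1) < x l" and high: "x k < x (l + 1)"
  shows "atniss_win (weak_ideal n x)"
proof -
  let ?L = "weak_ideal n x" and ?N = "nontrivial_ungar_moves (weak_ideal n x)"
  let ?s = "\<lambda>p. reverse_block p (Suc p)"
  define y where "y = x \<circ> reverse_block k l"
  define R where "R = {x \<circ> ?s p | p. k \<le> p \<and> p < l}"
  have inv_y: "inversions n y = inversions n x - {(i, j). inv x i \<in> {k..l} \<and> inv x j \<in> {k..l}}"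
    unfolding y_def using inversions_comp_reverse_block[OF x decr] .
  have y_perm: "y permutes {1..n}"
    unfolding y_def using x k by (intro permutes_compose reverse_block_permutes) auto
  have xL: "x \<in> carrier ?L" and yL: "y \<in> carrier ?L" using x y_perm inv_y by auto
  have cov_x: "x \<circ> ?s p \<in> covered_by ?L x" if "1 \<le> p" "p < n" "x (Suc p) < x p" for p
    unfolding covered_by_weak_ideal[OF xL] using that by blast
  have R_sub: "R \<subseteq> covered_by ?L x"
    unfolding R_def using k decr by (auto intro!: cov_x)
  have R_ne: "R \<noteq> {}" unfolding R_def using k by blast
  have cov_carrier: "covered_by ?L v \<subseteq> carrier ?L" for v
    unfolding covered_by_def by blast
  have Lower_eq: "Lower ?L A = {u \<in> carrier ?L. \<forall>a\<in>A. inversions n u \<subseteq> inversions n a}"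
    if "A \<subseteq> carrier ?L" for A
    unfolding Lower_def Int_absorb2[OF that] by auto
  \<comment> \<open>Below a swap inside the run, \<open>u\<close> does not invert the two swapped
    letters. Chaining these steps, \<open>u\<close> lists the whole run in increasing order and
    inverts no pair of it.\<close>
  have below_R: "(\<forall>a\<in>insert x R. inversions n u \<subseteq> inversions n a) \<longleftrightarrow> inversions n u \<subseteq> inversions n y"
    if u: "u permutes {1..n}" for u
  proof
    assume a: "\<forall>a\<in>insert x R. inversions n u \<subseteq> inversions n a"
    have step: "inv u (x (Suc p)) < inv u (x p)" if p: "k \<le> p" "p < l" for p
    proof -
      have d: "1 \<le> p" "p < n" "x (Suc p) < x p" using p k decr by auto
      have "x \<circ> ?s p \<in> R" using p by (auto simp: R_def)
      then have "(x (Suc p), x p) \<notin> inversions n u"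
        using a inversions_comp_adjacent(1)[OF x d] by blast
      then have "inv u (x (Suc p)) \<le> inv u (x p)"
        using d permutes_in_image[OF x, of p] permutes_in_image[OF x, of "Suc p"]
        by (auto simp: inversions_def)
      moreover have "inv u (x (Suc p)) \<noteq> inv u (x p)"
        using permutes_inverses(1)[OF u] d(3) by (metis less_irrefl)
      ultimately show ?thesis by simp
    qed
    have chain: "inv u (x q) < inv u (x p)" if "k \<le> p" "p < q" "q \<le> l" for p q
    proof -
      have "p < q \<Longrightarrow> q \<le> l \<Longrightarrow> inv u (x q) < inv u (x p)"
      proof (induction q)
        case (Suc q)
        then show ?case using step[of q] that(1) by (cases "p = q") auto
      qed simp
      with that show ?thesis by simp
    qed
    show "inversions n u \<subseteq> inversions n y"
    proof
      fix ij assume ij: "ij \<in> inversions n u"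
      obtain i j where [simp]: "ij = (i, j)" by force
      have gt: "i < j" "inv u i > inv u j" using ij by (auto simp: inversions_def)
      have "\<not> (inv x i \<in> {k..l} \<and> inv x j \<in> {k..l})"
      proof
        assume b: "inv x i \<in> {k..l} \<and> inv x j \<in> {k..l}"
        have [simp]: "x (inv x i) = i" "x (inv x j) = j" using permutes_inverses(1)[OF x] by auto
        have "inv x i \<noteq> inv x j" using gt(1) by (metis \<open>x (inv x i) = i\<close> \<open>x (inv x j) = j\<close> less_irrefl)
        then consider "inv x i < inv x j" | "inv x j < inv x i" by linarith
        then show False
          using decr[of "inv x i" "inv x j"] chain[of "inv x j" "inv x i"] b gt
          by cases auto
      qed
      then show "ij \<in> inversions n y" using ij a inv_y by auto
    qed
  next
    assume a: "inversions n u \<subseteq> inversions n y"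
    have "inversions n y \<subseteq> inversions n (x \<circ> ?s p)" if "k \<le> p" "p < l" for p
    proof -
      have d: "1 \<le> p" "p < n" "x (Suc p) < x p" using that k decr by auto
      show ?thesis
        using inversions_comp_adjacent(1)[OF x d] inv_y that permutes_inverses(2)[OF x] by auto
    qed
    then show "\<forall>a\<in>insert x R. inversions n u \<subseteq> inversions n a"
      using a inv_y unfolding R_def by blast
  qed
  have "y \<in> ?N x"
  proof -
    have "insert x R \<subseteq> carrier ?L" using R_sub cov_carrier xL by blast
    from Lower_eq[OF this] have "Lower ?L (insert x R) = {u \<in> carrier ?L. inversions n u \<subseteq> inversions n y}"
      by (simp only:) (intro Collect_cong conj_cong refl, rule below_R, simp)
    then have "Lower ?L ({x} \<union> R) = {u \<in> carrier ?L. inversions n u \<subseteq> inversions n y}"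
      by simp
    then have g: "greatest ?L y (Lower ?L ({x} \<union> R))"
      using yL by (auto simp: greatest_def)
    have "\<Sqinter>\<^bsub>?L\<^esub>({x} \<union> R) = y" unfolding inf_def
      by (rule some_equality) (fact g, rule weak_ideal_greatest_unique[OF _ g])
    then show ?thesis unfolding nontrivial_ungar_moves_def using R_sub R_ne by blast
  qed
  moreover have "?N y \<subseteq> ?N x"
  proof
    fix m assume "m \<in> ?N y"
    then obtain T' where T': "T' \<subseteq> covered_by ?L y" "T' \<noteq> {}" and m: "m = \<Sqinter>\<^bsub>?L\<^esub>({y} \<union> T')"
      unfolding nontrivial_ungar_moves_def by blast
    define D where "D = {p. 1 \<le> p \<and> p < n \<and> y (Suc p) < y p \<and> y \<circ> ?s p \<in> T'}"
    have T'_eq: "T' = (\<lambda>p. y \<circ> ?s p) ` D"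
      using T'(1) unfolding covered_by_weak_ideal[OF yL] D_def by auto
    have D: "1 \<le> p" "p < n" "x (Suc p) < x p" "y p = x p" "y (Suc p) = x (Suc p)"
      "y (Suc p) < y p" if "p \<in> D" for p
    proof -
      have d: "1 \<le> p" "p < n" "y (Suc p) < y p" using that by (auto simp: D_def)
      \<comment> \<open>By \<open>low\<close> and \<open>high\<close> both borders of the block are
        ascents of \<open>y\<close>, and the reversed run increases. So descents of \<open>y\<close>
        occur only where \<open>x\<close> and \<open>y\<close> agree.\<close>
      have "p \<noteq> k - 1"
        using d(3) low k by (cases k) (auto simp: y_def reverse_block_def)
      moreover have "p \<noteq> l"
        using d(3) high k by (auto simp: y_def reverse_block_def)
      moreover have "\<not> (k \<le> p \<and> p < l)"
      proof
        assume p: "k \<le> p \<and> p < l"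
        then have "k \<le> k + l - Suc p" "k + l - Suc p < k + l - p" "k + l - p \<le> l" by auto
        with p show False
          using d(3) decr[of "k + l - Suc p" "k + l - p"] by (auto simp: y_def reverse_block_def)
      qed
      ultimately have "p \<notin> {k..l}" "Suc p \<notin> {k..l}" by auto
      then show "y p = x p" "y (Suc p) = x (Suc p)" by (auto simp: y_def reverse_block_def)
      then show "1 \<le> p" "p < n" "x (Suc p) < x p" "y (Suc p) < y p" using d by auto
    qed
    define T where "T = R \<union> (\<lambda>p. x \<circ> ?s p) ` D"
    have T_sub: "T \<subseteq> covered_by ?L x"
      unfolding T_def using R_sub cov_x D by auto
    have T_carrier: "{x} \<union> T \<subseteq> carrier ?L" using T_sub cov_carrier xL by blast
    have T'_carrier: "{y} \<union> T' \<subseteq> carrier ?L" using T'(1) cov_carrier yL by blast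
    \<comment> \<open>Outside the block a swap at \<open>p\<close> deletes the same pair from the
      inversions of \<open>x\<close> and of \<open>y\<close>.\<close>
    have meet: "inversions n (y \<circ> ?s p) = inversions n y \<inter> inversions n (x \<circ> ?s p)" if "p \<in> D" for p
      using inversions_comp_adjacent(1)[OF x D(1-3)[OF that]]
        inversions_comp_adjacent(1)[OF y_perm D(1,2,6)[OF that]] D(4,5)[OF that] inv_y by auto
    have "(\<forall>a\<in>{y} \<union> T'. inversions n u \<subseteq> inversions n a) \<longleftrightarrow>
      (\<forall>a\<in>{x} \<union> T. inversions n u \<subseteq> inversions n a)" if "u permutes {1..n}" for u
    proof -
      have "(\<forall>a\<in>{y} \<union> T'. inversions n u \<subseteq> inversions n a) \<longleftrightarrow>
        inversions n u \<subseteq> inversions n y \<and> (\<forall>p\<in>D. inversions n u \<subseteq> inversions n (x \<circ> ?s p))"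
        unfolding T'_eq using meet by auto
      also have "\<dots> \<longleftrightarrow> (\<forall>a\<in>{x} \<union> T. inversions n u \<subseteq> inversions n a)"
        unfolding below_R[OF that, symmetric] T_def by auto
      finally show ?thesis .
    qed
    then have "Lower ?L ({y} \<union> T') = Lower ?L ({x} \<union> T)"
      unfolding Lower_eq[OF T_carrier] Lower_eq[OF T'_carrier]
      by (intro Collect_cong conj_cong refl) simp
    \<comment> \<open>The meet depends only on the set of lower bounds, so it need not be shown to
      exist.\<close>
    then have "m = \<Sqinter>\<^bsub>?L\<^esub>({x} \<union> T)" using m by (simp add: inf_def)
    moreover have "T \<noteq> {}" using R_ne by (auto simp: T_def)
    ultimately show "m \<in> ?N x" unfolding nontrivial_ungar_moves_def using T_sub by blast
  qed
  ultimately have "\<not> lost ?N x" by (rule strategy_stealing[where N = ?N])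
  then show ?thesis by (intro atniss_win_if_not_lost) (simp add: weak_ideal_top[OF x])
qed


section \<open>Words avoiding 1324 and 14325\<close>

text \<open>An occurrence of 1324 or of 14325 in the first letters of the word.\<close>

fun hit :: "nat list \<Rightarrow> bool" where
  "hit (c # b # a # d # xs) \<longleftrightarrow> c < a \<and> a < b \<and> b < d \<or>
     (case xs of [] \<Rightarrow> False | e # _ \<Rightarrow> c < d \<and> d < a \<and> a < b \<and> b < e)"
| "hit _ \<longleftrightarrow> False"

fun avoids :: "nat list \<Rightarrow> bool" where
  "avoids [] \<longleftrightarrow> True"
| "avoids (x # xs) \<longleftrightarrow> \<not> hit (x # xs) \<and> avoids xs"

lemma hit_less: "hit (x # y # xs) \<Longrightarrow> x < y"
  by (cases "x # y # xs" rule: hit.cases) (auto split: list.splits)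

lemma avoids_iff_tl: "avoids xs \<longleftrightarrow> \<not> hit xs \<and> avoids (tl xs)"
  by (cases xs) auto

section \<open>Counting words by the pattern of their first letters\<close>

definition avoiders :: "nat set \<Rightarrow> nat list set" where
  "avoiders V = {xs. distinct xs \<and> set xs = V \<and> avoids xs}"

definition num_avoiders :: "nat \<Rightarrow> nat" where
  "num_avoiders n = card (avoiders {..<n})"

lemma hit_map:
  assumes "strict_mono_on (set xs) g"
  shows "hit (map g xs) \<longleftrightarrow> hit xs"
proof -
  have lt: "g x < g y \<longleftrightarrow> x < y" if "x \<in> set xs" "y \<in> set xs" for x y
    using strict_mono_on_less[OF assms that] .
  show ?thesis
    using lt by (cases xs rule: hit.cases) (auto split: list.splits)
qed

lemma avoids_map:
  assumes "strict_mono_on (set xs) g"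
  shows "avoids (map g xs) \<longleftrightarrow> avoids xs"
  using assms
proof (induction xs)
  case (Cons x xs)
  then have "strict_mono_on (set xs) g" by (auto simp: strict_mono_on_def)
  then show ?case using Cons hit_map[of "x # xs" g] by simp
qed simp

lemma finite_avoiders: "finite V \<Longrightarrow> finite (avoiders V)"
  unfolding avoiders_def
  by (rule finite_subset[OF _ finite_subset_distinct[of V]]) auto

lemma card_avoiders:
  assumes "finite V"
  shows "card (avoiders V) = num_avoiders (card V)"
proof -
  obtain h where h: "bij_betw h {..<card V} V" "strict_mono_on {..<card V} h"
    using ex_bij_betw_strict_mono_card[OF assms] .
  have img: "h ` {..<card V} = V" and inj: "inj_on h {..<card V}"
    using h(1) by (auto simp: bij_betw_def)
  have "bij_betw (map h) (avoiders {..<card V}) (avoiders V)"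
  proof (rule bij_betw_imageI)
    show "inj_on (map h) (avoiders {..<card V})"
      by (rule inj_on_mapI) (use inj in \<open>auto simp: avoiders_def intro: inj_on_subset\<close>)
    show "map h ` avoiders {..<card V} = avoiders V"
    proof (intro equalityI subsetI)
      fix ys assume "ys \<in> map h ` avoiders {..<card V}"
      then show "ys \<in> avoiders V"
        using h(2) inj img avoids_map[of _ h] by (auto simp: avoiders_def distinct_map)
    next
      fix ys assume ys: "ys \<in> avoiders V"
      define xs where "xs = map (the_inv_into {..<card V} h) ys"
      have ys_eq: "ys = map h xs"
        unfolding xs_def map_map using ys img f_the_inv_into_f[OF inj]
        by (intro map_idI[symmetric]) (auto simp: avoiders_def)
      have set_xs: "set xs = {..<card V}"
        using ys the_inv_into_onto[OF inj] img by (simp add: xs_def avoiders_def)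
      have "distinct xs" using ys ys_eq by (auto simp: avoiders_def distinct_map)
      then have "xs \<in> avoiders {..<card V}"
        using set_xs ys avoids_map[of xs h] h(2) ys_eq by (simp add: avoiders_def)
      then show "ys \<in> map h ` avoiders {..<card V}" using ys_eq by blast
    qed
  qed
  then show ?thesis unfolding num_avoiders_def by (simp add: bij_betw_same_card)
qed

text \<open>
  Words over \<open>V\<close> whose first letters are ordered like the letters of \<open>p\<close> (counted from 0) and whose
  remaining letters avoid both patterns.
\<close>

definition start_with :: "nat set \<Rightarrow> nat list \<Rightarrow> nat list set" where
  "start_with V p = {map ((!) ls) p @ ys | ls ys.
     sorted_wrt (<) ls \<and> length ls = length p \<and> set ls \<subseteq> V \<and> ys \<in> avoiders (V - set ls)}"

lemma start_with_eq_image: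
  assumes "finite V"
  shows "start_with V p = (\<lambda>(A, ys). map ((!) (sorted_list_of_set A)) p @ ys) `
     (SIGMA A:{A. A \<subseteq> V \<and> card A = length p}. avoiders (V - A))" (is "_ = ?f ` ?S")
proof (intro equalityI subsetI)
  fix xs assume "xs \<in> start_with V p"
  then obtain ls ys where xs: "xs = map ((!) ls) p @ ys" and ls: "sorted_wrt (<) ls"
    "length ls = length p" "set ls \<subseteq> V" "ys \<in> avoiders (V - set ls)"
    unfolding start_with_def by blast
  have "sorted ls" "distinct ls" using ls(1) by (auto simp: strict_sorted_iff)
  then have "sorted_list_of_set (set ls) = ls" "card (set ls) = length p"
    using ls(2) sorted_list_of_set.idem_if_sorted_distinct distinct_card[of ls] by auto
  then show "xs \<in> ?f ` ?S"
    using ls xs by (intro image_eqI[of _ _ "(set ls, ys)"]) auto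
next
  fix xs assume "xs \<in> ?f ` ?S"
  then obtain A ys where A: "A \<subseteq> V" "card A = length p" "ys \<in> avoiders (V - A)"
    and xs: "xs = map ((!) (sorted_list_of_set A)) p @ ys" by auto
  have "finite A" using A(1) assms finite_subset by blast
  then show "xs \<in> start_with V p" unfolding start_with_def
    using A xs by (intro CollectI exI[of _ "sorted_list_of_set A"] exI[of _ ys]) auto
qed

lemma finite_start_with: "finite V \<Longrightarrow> finite (start_with V p)"
  unfolding start_with_eq_image
  by (intro finite_imageI finite_SigmaI) (auto intro!: finite_avoiders)

text \<open>The set \<open>A\<close> of first letters is free, \<open>p\<close> fixes their order,
  and any avoider on the other letters may follow. As \<open>p\<close> is a permutation,
  \<open>A\<close> can be read off from the word, so nothing is counted twice.\<close>

lemma card_start_with: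
  assumes "finite V" and p: "set p = {..<length p}"
  shows "card (start_with V p) = (card V choose length p) * num_avoiders (card V - length p)"
proof -
  let ?f = "\<lambda>(A, ys). map ((!) (sorted_list_of_set A)) p @ ys"
  let ?S = "SIGMA A:{A. A \<subseteq> V \<and> card A = length p}. avoiders (V - A)"
  have "inj_on ?f ?S"
  proof (rule inj_onI, clarify)
    fix A ys B zs
    assume A: "A \<subseteq> V" "card A = length p" and B: "B \<subseteq> V" "card B = length p"
      and eq: "map ((!) (sorted_list_of_set A)) p @ ys = map ((!) (sorted_list_of_set B)) p @ zs"
    have "set (map ((!) (sorted_list_of_set C)) p) = C" if "C \<subseteq> V" "card C = length p" for C
    proof -
      have "finite C" using that(1) assms(1) finite_subset by blast
      have "set (map ((!) (sorted_list_of_set C)) p) =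
          (!) (sorted_list_of_set C) ` {..<length (sorted_list_of_set C)}"
        using p that by simp
      also have "\<dots> = set (sorted_list_of_set C)" by (auto simp: set_conv_nth)
      finally show ?thesis using \<open>finite C\<close> by simp
    qed
    then show "A = B \<and> ys = zs" using A B eq
      by (metis append_eq_append_conv length_map)
  qed
  then have "card (start_with V p) = card ?S"
    unfolding start_with_eq_image[OF assms(1)] by (rule card_image)
  also have "\<dots> = (\<Sum>A\<in>{A. A \<subseteq> V \<and> card A = length p}. card (avoiders (V - A)))"
    by (rule card_SigmaI) (use assms in \<open>auto intro!: finite_avoiders\<close>)
  also have "\<dots> = (\<Sum>A\<in>{A. A \<subseteq> V \<and> card A = length p}. num_avoiders (card V - length p))"
  proof (rule sum.cong[OF refl])
    fix A assume "A \<in> {A. A \<subseteq> V \<and> card A = length p}"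
    then show "card (avoiders (V - A)) = num_avoiders (card V - length p)"
      using assms(1) card_Diff_subset[of A V] finite_subset[of A V]
      by (simp add: card_avoiders)
  qed
  also have "\<dots> = (card V choose length p) * num_avoiders (card V - length p)"
    using n_subsets[OF assms(1)] by simp
  finally show ?thesis .
qed

text \<open>Dividing by \<open>fact n\<close> absorbs the binomial coefficients, so the recurrences
  below have constant coefficients.\<close>

definition avoid_prob :: "nat \<Rightarrow> real" where
  "avoid_prob n = real (num_avoiders n) / fact n"

lemma card_start_with_prob:
  assumes "set p = {..<length p}" and "length p \<le> n"
  shows "real (card (start_with {..<n} p)) / fact n = avoid_prob (n - length p) / fact (length p)"
  using assms by (simp add: card_start_with avoid_prob_def binomial_fact field_simps)

text \<open>If the pattern is longer than the word, the left side is 0 and truncated subtraction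
  keeps the right side nonnegative. The bound thus covers small \<open>n\<close> as well.\<close>

lemma card_start_with_prob_le:
  assumes "set p = {..<length p}"
  shows "real (card (start_with {..<n} p)) / fact n \<le> avoid_prob (n - length p) / fact (length p)"
proof (cases "length p \<le> n")
  case True
  then show ?thesis using card_start_with_prob[OF assms] by simp
next
  case False
  then show ?thesis using assms by (simp add: card_start_with avoid_prob_def binomial_eq_0)
qed

lemma start_withI:
  assumes "distinct xs" "set xs = V"
    and "xs = map ((!) ls) p @ ys" "sorted_wrt (<) ls" "length ls = length p" "avoids ys" "set (map ((!) ls) p) = set ls"
  shows "xs \<in> start_with V p"
proof -
  have "ys \<in> avoiders (V - set ls)" using assms by (auto simp: avoiders_def)
  moreover have "set ls \<subseteq> V" using assms by auto
  ultimately show ?thesis using assms unfolding start_with_def by blast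
qed

lemma start_withE:
  assumes "xs \<in> start_with V p" and "set p = {..<length p}"
  obtains ls ys where "xs = map ((!) ls) p @ ys" "sorted_wrt (<) ls" "length ls = length p"
    "distinct xs" "set xs = V" "avoids ys"
proof -
  obtain ls ys where *: "xs = map ((!) ls) p @ ys" "sorted_wrt (<) ls" "length ls = length p"
    "set ls \<subseteq> V" "ys \<in> avoiders (V - set ls)"
    using assms(1) unfolding start_with_def by blast
  have set_eq: "set (map ((!) ls) p) = set ls"
  proof -
    have "set (map ((!) ls) p) = (!) ls ` {..<length ls}" using assms(2) *(3) by simp
    also have "\<dots> = set ls" by (auto simp: set_conv_nth)
    finally show ?thesis .
  qed
  have "distinct p" using assms(2) by (simp add: card_distinct)
  moreover have "distinct ls" using *(2) by (simp add: strict_sorted_iff)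
  ultimately have "distinct (map ((!) ls) p)"
    using assms(2) *(3) by (auto simp: distinct_map inj_on_def nth_eq_iff_index_eq)
  then have "distinct xs" "set xs = V" using * set_eq by (auto simp: avoiders_def)
  then show thesis using that * by (auto simp: avoiders_def)
qed

section \<open>Words whose only hit is at the front\<close>

definition fresh_hits :: "nat \<Rightarrow> nat list set" where
  "fresh_hits n = {xs. distinct xs \<and> set xs = {..<n} \<and> hit xs \<and> avoids (tl xs)}"

text \<open>Both sides count the words whose tail avoids the patterns: on the right by their free
  first letter, on the left by whether the whole word starts with a hit.\<close>

lemma num_avoiders_rec:
  assumes "n \<ge> 1"
  shows "num_avoiders n + card (fresh_hits n) = n * num_avoiders (n - 1)"
proof -
  have "start_with {..<n} [0] = {xs. distinct xs \<and> set xs = {..<n} \<and> avoids (tl xs)}" (is "_ = ?R")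
  proof (intro equalityI subsetI)
    fix xs assume "xs \<in> start_with {..<n} [0]"
    then show "xs \<in> ?R"
      by (elim start_withE) (auto simp: length_Suc_conv)
  next
    fix xs assume xs: "xs \<in> ?R"
    have "set xs = {..<n}" using xs by simp
    then have "0 \<in> set xs" using assms by simp
    then have "xs \<noteq> []" by force
    then obtain y ys where [simp]: "xs = y # ys" by (cases xs) auto
    show "xs \<in> start_with {..<n} [0]"
      by (rule start_withI[where ls = "[y]" and ys = ys]) (use xs in simp_all)
  qed
  also have "\<dots> = avoiders {..<n} \<union> fresh_hits n"
    unfolding avoiders_def fresh_hits_def using avoids_iff_tl by blast
  finally have eq: "start_with {..<n} [0] = avoiders {..<n} \<union> fresh_hits n" .
  have disj: "avoiders {..<n} \<inter> fresh_hits n = {}"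
    unfolding avoiders_def fresh_hits_def using avoids_iff_tl by blast
  have "finite (avoiders {..<n} \<union> fresh_hits n)"
    unfolding eq[symmetric] by (simp add: finite_start_with)
  then have "card (start_with {..<n} [0]) = card (avoiders {..<n}) + card (fresh_hits n)"
    unfolding eq using disj by (simp add: card_Un_disjoint)
  then show ?thesis by (simp add: card_start_with lessThan_Suc num_avoiders_def)
qed

lemma avoid_prob_rec:
  assumes "n \<ge> 1"
  shows "avoid_prob n = avoid_prob (n - 1) - card (fresh_hits n) / fact n"
proof -
  have "real (num_avoiders n) = real n * num_avoiders (n - 1) - card (fresh_hits n)"
    using num_avoiders_rec[OF assms] by (metis add_diff_cancel_right' of_nat_add of_nat_mult)
  moreover have "(fact n :: real) = n * fact (n - 1)" using assms by (simp add: fact_reduce)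
  ultimately show ?thesis using assms by (simp add: avoid_prob_def field_simps)
qed

abbreviation "hit_patterns \<equiv> [[0,2,1,3], [0,3,2,1,4::nat]]"

text \<open>
  The ways in which a word that starts with a hit can have a further hit within its tail. For an
  initial 1324 they are listed exactly: overlaps in two letters (first two rows) and in one letter
  (third row). For an initial 14325 it suffices to record that the sixth letter exceeds the fourth.
\<close>

abbreviation "overlap_patterns \<equiv>
  [[0,2,1,4,3,5], [0,3,1,4,2,5],
   [0,2,1,5,4,3,6], [0,3,1,5,4,2,6], [0,4,1,5,3,2,6],
   [0,2,1,3,5,4,6], [0,2,1,3,6,5,4,7],
   [0,4,3,1,5,2], [0,4,2,1,5,3], [0,3,2,1,5,4], [0,3,2,1,4,5::nat]]"

lemma pattern_entries: "p \<in> set (hit_patterns @ overlap_patterns) \<Longrightarrow> set p = {..<length p}"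
  by (auto simp: lessThan_Suc numeral_eq_Suc)

lemma fresh_hits_subset: "fresh_hits n \<subseteq> (\<Union>p\<in>set hit_patterns. start_with {..<n} p)"
proof
  fix xs assume "xs \<in> fresh_hits n"
  then have xs: "distinct xs" "set xs = {..<n}" and hit: "hit xs" and av: "avoids (tl xs)"
    by (auto simp: fresh_hits_def)
  obtain c b a d ys where eq: "xs = c # b # a # d # ys"
    using hit by (cases xs rule: hit.cases) auto
  consider "c < a" "a < b" "b < d" | e zs where "ys = e # zs" "c < d" "d < a" "a < b" "b < e"
    using hit eq by (auto split: list.splits)
  then show "xs \<in> (\<Union>p\<in>set hit_patterns. start_with {..<n} p)"
  proof cases
    case 1
    have "xs \<in> start_with {..<n} [0,2,1,3]"
      by (rule start_withI[OF xs, where ls = "[c,a,b,d]" and ys = ys]) (use av eq 1 in auto)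
    then show ?thesis by simp
  next
    case 2
    have "xs \<in> start_with {..<n} [0,3,2,1,4]"
      by (rule start_withI[OF xs, where ls = "[c,d,a,b,e]" and ys = zs]) (use av eq 2 in auto)
    then show ?thesis by simp
  qed
qed

text \<open>By \<open>hit_less\<close> no hit starts at a descent, and the letters after the first
  hit avoid both patterns. So a second hit starts at one of the last two letters of the first; the
  cases rank its new letters among the old ones.\<close>

lemma hit_patterns_subset:
  "(\<Union>p\<in>set hit_patterns. start_with {..<n} p) \<subseteq> fresh_hits n \<union> (\<Union>p\<in>set overlap_patterns. start_with {..<n} p)"
proof
  fix xs assume "xs \<in> (\<Union>p\<in>set hit_patterns. start_with {..<n} p)"
  then consider "xs \<in> start_with {..<n} [0,2,1,3]" | "xs \<in> start_with {..<n} [0,3,2,1,4]" by auto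
  then show "xs \<in> fresh_hits n \<union> (\<Union>p\<in>set overlap_patterns. start_with {..<n} p)"
  proof cases
    case 1
    obtain ls ys where ls: "xs = map ((!) ls) [0,2,1,3] @ ys" "sorted_wrt (<) ls"
      "length ls = length [0,2,1,3::nat]"
      and xs: "distinct xs" "set xs = {..<n}" and ys: "avoids ys"
      by (rule start_withE[OF 1 pattern_entries], simp, rule that)
    obtain c a b d where "ls = [c,a,b,d]"
      using ls(3) by (auto simp: length_Suc_conv numeral_eq_Suc)
    then have eq: "xs = c # b # a # d # ys" and ord: "c < a" "a < b" "b < d"
      using ls by auto
    show ?thesis
    proof (cases "avoids (tl xs)")
      case True
      have "hit xs" using eq ord by simp
      then show ?thesis using True xs by (simp add: fresh_hits_def)
    next
      case False
      then consider "hit (a # d # ys)" | "hit (d # ys)"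
        using eq ord ys hit_less[of b a "d # ys"] by (auto simp del: hit.simps)
      then show ?thesis
      proof cases
        case 1
        then consider e g zs where "ys = e # g # zs" "a < e" "e < d" "d < g"
          | e f g zs where "ys = e # f # g # zs" "a < f" "f < e" "e < d" "d < g"
          by (cases "a # d # ys" rule: hit.cases) (auto split: list.splits)
        then show ?thesis
        proof cases
          case 1
          have "e \<noteq> b" using xs eq 1 by auto
          then consider "e < b" | "b < e" by linarith
          then show ?thesis
          proof cases
            case l: 1
            have "xs \<in> start_with {..<n} [0,3,1,4,2,5]"
              by (rule start_withI[OF xs, where ls = "[c,a,e,b,d,g]" and ys = zs]) (use ys eq ord 1 l in auto)
            then show ?thesis by simp
          next
            case l: 2
            have "xs \<in> start_with {..<n} [0,2,1,4,3,5]"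
              by (rule start_withI[OF xs, where ls = "[c,a,b,e,d,g]" and ys = zs]) (use ys eq ord 1 l in auto)
            then show ?thesis by simp
          qed
        next
          case 2
          have "e \<noteq> b" "f \<noteq> b" using xs eq 2 by auto
          then consider "e < b" | "f < b" "b < e" | "b < f" by linarith
          then show ?thesis
          proof cases
            case l: 1
            have "xs \<in> start_with {..<n} [0,4,1,5,3,2,6]"
              by (rule start_withI[OF xs, where ls = "[c,a,f,e,b,d,g]" and ys = zs]) (use ys eq ord 2 l in auto)
            then show ?thesis by simp
          next
            case l: 2
            have "xs \<in> start_with {..<n} [0,3,1,5,4,2,6]"
              by (rule start_withI[OF xs, where ls = "[c,a,f,b,e,d,g]" and ys = zs]) (use ys eq ord 2 l in auto)
            then show ?thesis by simp
          next
            case l: 3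
            have "xs \<in> start_with {..<n} [0,2,1,5,4,3,6]"
              by (rule start_withI[OF xs, where ls = "[c,a,b,f,e,d,g]" and ys = zs]) (use ys eq ord 2 l in auto)
            then show ?thesis by simp
          qed
        qed
      next
        case 2
        then consider e f g zs where "ys = e # f # g # zs" "d < f" "f < e" "e < g"
          | e f g h zs where "ys = e # f # g # h # zs" "d < g" "g < f" "f < e" "e < h"
          by (cases "d # ys" rule: hit.cases) (auto split: list.splits)
        then show ?thesis
        proof cases
          case l: 1
          have "xs \<in> start_with {..<n} [0,2,1,3,5,4,6]"
            by (rule start_withI[OF xs, where ls = "[c,a,b,d,f,e,g]" and ys = zs]) (use ys eq ord l in auto)
          then show ?thesis by simp
        next
          case l: 2
          have "xs \<in> start_with {..<n} [0,2,1,3,6,5,4,7]"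
            by (rule start_withI[OF xs, where ls = "[c,a,b,d,g,f,e,h]" and ys = zs]) (use ys eq ord l in auto)
          then show ?thesis by simp
        qed
      qed
    qed
  next
    case 2
    obtain ls ys where ls: "xs = map ((!) ls) [0,3,2,1,4] @ ys" "sorted_wrt (<) ls"
      "length ls = length [0,3,2,1,4::nat]"
      and xs: "distinct xs" "set xs = {..<n}" and ys: "avoids ys"
      by (rule start_withE[OF 2 pattern_entries], simp, rule that)
    obtain c a1 a2 a3 d where "ls = [c,a1,a2,a3,d]"
      using ls(3) by (auto simp: length_Suc_conv numeral_eq_Suc)
    then have eq: "xs = c # a3 # a2 # a1 # d # ys" and ord: "c < a1" "a1 < a2" "a2 < a3" "a3 < d"
      using ls by auto
    show ?thesis
    proof (cases "avoids (tl xs)")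
      case True
      have "hit xs" using eq ord by simp
      then show ?thesis using True xs by (simp add: fresh_hits_def)
    next
      case False
      then have "hit (a1 # d # ys) \<or> hit (d # ys)"
        using eq ord ys hit_less[of a3 a2 "a1 # d # ys"] hit_less[of a2 a1 "d # ys"]
        by (auto simp del: hit.simps)
      \<comment> \<open>In both patterns the third letter exceeds the first, and a hit starting at
        \<open>d\<close> gives \<open>d < e\<close>. Either way \<open>a1 < e\<close>, which leaves
        four possible ranks for \<open>e\<close>.\<close>
      then obtain e zs where e: "ys = e # zs" "a1 < e"
        using ord by (cases ys rule: hit.cases) (auto split: list.splits)
      have "e \<noteq> a2" "e \<noteq> a3" "e \<noteq> d" using xs eq e by auto
      then consider "e < a2" | "a2 < e" "e < a3" | "a3 < e" "e < d" | "d < e" by linarith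
      then show ?thesis
      proof cases
        case l: 1
        have "xs \<in> start_with {..<n} [0,4,3,1,5,2]"
          by (rule start_withI[OF xs, where ls = "[c,a1,e,a2,a3,d]" and ys = zs]) (use ys eq ord e l in auto)
        then show ?thesis by simp
      next
        case l: 2
        have "xs \<in> start_with {..<n} [0,4,2,1,5,3]"
          by (rule start_withI[OF xs, where ls = "[c,a1,a2,e,a3,d]" and ys = zs]) (use ys eq ord e l in auto)
        then show ?thesis by simp
      next
        case l: 3
        have "xs \<in> start_with {..<n} [0,3,2,1,5,4]"
          by (rule start_withI[OF xs, where ls = "[c,a1,a2,a3,e,d]" and ys = zs]) (use ys eq ord e l in auto)
        then show ?thesis by simp
      next
        case l: 4
        have "xs \<in> start_with {..<n} [0,3,2,1,4,5]"
          by (rule start_withI[OF xs, where ls = "[c,a1,a2,a3,d,e]" and ys = zs]) (use ys eq ord e l in auto)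
        then show ?thesis by simp
      qed
    qed
  qed
qed

section \<open>Growth rate\<close>

lemma avoid_prob_nonneg: "avoid_prob n \<ge> 0"
  by (simp add: avoid_prob_def)

lemma avoid_prob_mono: "avoid_prob n \<le> avoid_prob (n - 1)"
  using avoid_prob_rec[of n] by (cases n) auto

lemma avoid_prob_ge:
  assumes "n \<ge> 1"
  shows "avoid_prob n \<ge> avoid_prob (n - 1) - avoid_prob (n - 4) / 24 - avoid_prob (n - 5) / 120"
proof -
  let ?C = "\<lambda>p. real (card (start_with {..<n} p)) / fact n"
  have "card (fresh_hits n) \<le> card (\<Union>p\<in>set hit_patterns. start_with {..<n} p)"
    by (rule card_mono[OF _ fresh_hits_subset]) (auto intro: finite_start_with)
  also have "\<dots> \<le> card (start_with {..<n} [0,2,1,3]) + card (start_with {..<n} [0,3,2,1,4])"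
    using card_Un_le by simp
  finally have "real (card (fresh_hits n)) / fact n \<le> ?C [0,2,1,3] + ?C [0,3,2,1,4]"
    by (simp add: field_simps flip: of_nat_add)
  also have "\<dots> \<le> avoid_prob (n - 4) / 24 + avoid_prob (n - 5) / 120"
    using card_start_with_prob_le[OF pattern_entries, of "[0,2,1,3]" n]
      card_start_with_prob_le[OF pattern_entries, of "[0,3,2,1,4]" n]
    by (intro add_mono) (simp_all add: numeral_eq_Suc)
  finally show ?thesis using avoid_prob_rec[OF assms] by simp
qed

text \<open>The constant works because
  \<open>1 - 1 / (24 * 0.937 ^ 3) - 1 / (120 * 0.937 ^ 4)\<close> is about 0.9385; the induction
  hypotheses bound the two subtracted terms in this way.\<close>

lemma avoid_prob_ratio_ge: "0.937 * avoid_prob (n - 1) \<le> avoid_prob n"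
proof (induction n rule: less_induct)
  case (less n)
  show ?case
  proof (cases "n = 0")
    case True
    then show ?thesis using avoid_prob_nonneg[of 0] by simp
  next
    case False
    then show ?thesis
      using avoid_prob_ge[of n] avoid_prob_nonneg[of "n - 1"]
        less.IH[of "n - 1"] less.IH[of "n - 2"] less.IH[of "n - 3"] less.IH[of "n - 4"]
      by (simp add: numeral_eq_Suc)
  qed
qed

lemma start_with_hit_patterns_disjoint: "start_with V [0,2,1,3] \<inter> start_with V [0,3,2,1,4] = {}"
proof -
  have "xs ! 2 < xs ! 3" if "xs \<in> start_with V [0,2,1,3]" for xs
    using that by (elim start_withE) (auto simp: pattern_entries nth_append sorted_wrt_nth_less numeral_eq_Suc)
  moreover have "xs ! 3 < xs ! 2" if "xs \<in> start_with V [0,3,2,1,4]" for xs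
    using that by (elim start_withE) (auto simp: pattern_entries nth_append sorted_wrt_nth_less numeral_eq_Suc)
  ultimately show ?thesis by (meson disjoint_iff less_asym)
qed

text \<open>There are six overlap patterns of length 6, four of length 7 and one of length 8, whence
  6/720 = 1/120, 4/5040 = 1/1260 and 1/40320. For \<open>n \<ge> 8\<close> no subtraction truncates,
  so the counts are exact.\<close>

lemma avoid_prob_le:
  assumes "n \<ge> 8"
  shows "avoid_prob n \<le> avoid_prob (n - 1) - avoid_prob (n - 4) / 24 - avoid_prob (n - 5) / 120
    + avoid_prob (n - 6) / 120 + avoid_prob (n - 7) / 1260 + avoid_prob (n - 8) / 40320"
proof -
  let ?C = "\<lambda>p. real (card (start_with {..<n} p)) / fact n"
  have "card (start_with {..<n} [0,2,1,3]) + card (start_with {..<n} [0,3,2,1,4]) =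
      card (\<Union>p\<in>set hit_patterns. start_with {..<n} p)"
    using start_with_hit_patterns_disjoint by (simp add: card_Un_disjoint finite_start_with)
  also have "\<dots> \<le> card (fresh_hits n \<union> (\<Union>p\<in>set overlap_patterns. start_with {..<n} p))"
  proof (rule card_mono[OF _ hit_patterns_subset])
    have "finite (fresh_hits n)"
      by (rule finite_subset[OF fresh_hits_subset]) (auto intro: finite_start_with)
    then show "finite (fresh_hits n \<union> (\<Union>p\<in>set overlap_patterns. start_with {..<n} p))"
      by (auto intro: finite_start_with)
  qed
  also have "\<dots> \<le> card (fresh_hits n) + card (\<Union>p\<in>set overlap_patterns. start_with {..<n} p)"
    by (rule card_Un_le)
  also have "\<dots> \<le> card (fresh_hits n) + (\<Sum>p\<in>set overlap_patterns. card (start_with {..<n} p))"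
    by (intro add_left_mono card_UN_le) simp
  finally have "real (card (start_with {..<n} [0,2,1,3])) + real (card (start_with {..<n} [0,3,2,1,4]))
      \<le> real (card (fresh_hits n)) + (\<Sum>p\<in>set overlap_patterns. real (card (start_with {..<n} p)))"
    unfolding of_nat_sum[symmetric] of_nat_add[symmetric] of_nat_le_iff .
  then have "(real (card (start_with {..<n} [0,2,1,3])) + real (card (start_with {..<n} [0,3,2,1,4]))) / fact n
      \<le> (real (card (fresh_hits n)) + (\<Sum>p\<in>set overlap_patterns. real (card (start_with {..<n} p)))) / fact n"
    by (rule divide_right_mono) simp
  then have "?C [0,2,1,3] + ?C [0,3,2,1,4] \<le> card (fresh_hits n) / fact n + (\<Sum>p\<in>set overlap_patterns. ?C p)"
    by (simp only: add_divide_distrib sum_divide_distrib)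
  moreover have C: "?C p = avoid_prob (n - length p) / fact (length p)" if "p \<in> set (hit_patterns @ overlap_patterns)" for p
  proof (rule card_start_with_prob)
    have "length p \<le> 8" using that by auto
    then show "length p \<le> n" using assms by simp
  qed (rule pattern_entries[OF that])
  have "?C [0,2,1,3] = avoid_prob (n - 4) / 24" "?C [0,3,2,1,4] = avoid_prob (n - 5) / 120"
    using C[of "[0,2,1,3]"] C[of "[0,3,2,1,4]"] by (simp_all add: numeral_eq_Suc)
  moreover have "(\<Sum>p\<in>set overlap_patterns. ?C p) =
      (\<Sum>p\<in>set overlap_patterns. avoid_prob (n - length p) / fact (length p))"
    by (rule sum.cong[OF refl], rule C) simp
  moreover have "(\<Sum>p\<in>set overlap_patterns. avoid_prob (n - length p) / fact (length p)) =
     avoid_prob (n - 6) / 120 + avoid_prob (n - 7) / 1260 + avoid_prob (n - 8) / 40320"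
    by (simp, simp add: numeral_eq_Suc)
  ultimately show ?thesis using avoid_prob_rec[of n] assms by simp
qed

text \<open>A smaller \<open>h\<close> makes \<open>avoid_prob (n - 4)\<close> larger relative to
  \<open>avoid_prob (n - 1)\<close>, which strengthens the main negative term of the recurrence; the
  factor 0.937 controls the positive terms. Each \<open>h'\<close> is rounded up.\<close>

lemma avoid_prob_ratio_improve:
  fixes h h' :: real
  assumes h: "\<And>n. n \<ge> N \<Longrightarrow> avoid_prob n \<le> h * avoid_prob (n - 1)"
    and n: "n \<ge> N + 8" and hh': "(h, h') \<in> {(1, 0.963), (0.963, 0.9565), (0.9565, 0.95586)}"
  shows "avoid_prob n \<le> h' * avoid_prob (n - 1)"
proof -
  have up: "avoid_prob (n - 1) \<le> h * avoid_prob (n - 2)" "avoid_prob (n - 2) \<le> h * avoid_prob (n - 3)"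
    "avoid_prob (n - 3) \<le> h * avoid_prob (n - 4)" "avoid_prob (n - 4) \<le> h * avoid_prob (n - 5)"
    using n h[of "n - 1"] h[of "n - 2"] h[of "n - 3"] h[of "n - 4"] by (simp_all add: numeral_eq_Suc)
  have low_step: "0.937 * avoid_prob (n - Suc i) \<le> avoid_prob (n - i)" for i
    using avoid_prob_ratio_ge[of "n - i"] by simp
  have low: "0.937 * avoid_prob (n - 2) \<le> avoid_prob (n - 1)" "0.937 * avoid_prob (n - 3) \<le> avoid_prob (n - 2)"
    "0.937 * avoid_prob (n - 4) \<le> avoid_prob (n - 3)" "0.937 * avoid_prob (n - 5) \<le> avoid_prob (n - 4)"
    "0.937 * avoid_prob (n - 6) \<le> avoid_prob (n - 5)" "0.937 * avoid_prob (n - 7) \<le> avoid_prob (n - 6)"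
    "0.937 * avoid_prob (n - 8) \<le> avoid_prob (n - 7)"
    using low_step[of 1] low_step[of 2] low_step[of 3] low_step[of 4] low_step[of 5] low_step[of 6]
      low_step[of 7]
    by (simp_all add: numeral_eq_Suc)
  have "n \<ge> 8" using n by simp
  note rec = avoid_prob_le[OF this]
  \<comment> \<open>Once \<open>h\<close> and \<open>h'\<close> are numerals, the claim is linear in
    the values of \<open>avoid_prob\<close>.\<close>
  from hh' consider "h = 1" "h' = 0.963" | "h = 0.963" "h' = 0.9565" | "h = 0.9565" "h' = 0.95586"
    by auto
  then show ?thesis
  proof cases
    case 1
    show ?thesis using up low rec avoid_prob_nonneg[of "n - 1"] unfolding 1 by simp
  next
    case 2
    show ?thesis using up low rec avoid_prob_nonneg[of "n - 1"] unfolding 2 by simp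
  next
    case 3
    show ?thesis using up low rec avoid_prob_nonneg[of "n - 1"] unfolding 3 by simp
  qed
qed

text \<open>Each of the three rounds raises the threshold by eight: 8, 16, 24.\<close>

lemma avoid_prob_ratio_le: "n \<ge> 24 \<Longrightarrow> avoid_prob n \<le> 0.95586 * avoid_prob (n - 1)"
proof -
  have 1: "avoid_prob n \<le> 0.963 * avoid_prob (n - 1)" if "n \<ge> 8" for n
    by (rule avoid_prob_ratio_improve[of 0 1]) (use that avoid_prob_mono in auto)
  have 2: "avoid_prob n \<le> 0.9565 * avoid_prob (n - 1)" if "n \<ge> 16" for n
    by (rule avoid_prob_ratio_improve[of 8 "0.963", OF 1]) (use that in auto)
  show "avoid_prob n \<le> 0.95586 * avoid_prob (n - 1)" if "n \<ge> 24"
    by (rule avoid_prob_ratio_improve[of 16 "0.9565", OF 2]) (use that in auto)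
qed

lemma avoid_prob_geometric: "avoid_prob (k + 24) \<le> 0.95586 ^ k * avoid_prob 24"
proof (induction k)
  case (Suc k)
  have "avoid_prob (Suc k + 24) \<le> 0.95586 * avoid_prob (k + 24)"
    using avoid_prob_ratio_le[of "Suc k + 24"] by (simp add: add.commute)
  also have "\<dots> \<le> 0.95586 * (0.95586 ^ k * avoid_prob 24)"
    by (rule mult_left_mono[OF Suc]) simp
  finally show ?case by (simp only: power_Suc mult.assoc)
qed simp

section \<open>Counting Eeta wins\<close>

lemma hit_nth:
  assumes "hit xs"
  shows "length xs \<ge> 4 \<and> xs ! 0 < xs ! 2 \<and> xs ! 2 < xs ! 1 \<and> xs ! 1 < xs ! 3 \<or>
    length xs \<ge> 5 \<and> xs ! 0 < xs ! 3 \<and> xs ! 3 < xs ! 2 \<and> xs ! 2 < xs ! 1 \<and> xs ! 1 < xs ! 4"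
  using assms by (cases xs rule: hit.cases) (auto simp: numeral_eq_Suc split: list.splits)

lemma not_avoids_imp_hit_drop: "\<not> avoids xs \<Longrightarrow> \<exists>i. hit (drop i xs)"
proof (induction xs)
  case (Cons x xs)
  then show ?case by (metis avoids.simps(2) drop0 drop_Suc_Cons)
qed simp

lemma not_avoids_imp_atniss_win:
  assumes w: "w permutes {1..n}" and "\<not> avoids (map w [1..<Suc n])"
  shows "atniss_win (weak_ideal n w)"
proof -
  obtain i where "hit (drop i (map w [1..<Suc n]))"
    using not_avoids_imp_hit_drop[OF assms(2)] by blast
  define ys where "ys = drop i (map w [1..<Suc n])"
  have hit: "hit ys" unfolding ys_def by fact
  have len_ys: "length ys = n - i" by (simp add: ys_def del: upt_Suc)
  \<comment> \<open>List indices start at 0 but positions of \<open>w\<close> at 1, so the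
    descending run of a hit at offset \<open>i\<close> starts at position
    \<open>i + 2\<close>.\<close>
  have nth: "ys ! j = w (Suc i + j)" if "i + j < n" for j
    using that by (simp add: ys_def del: upt_Suc)
  from hit_nth[OF hit] show ?thesis
  proof
    assume *: "length ys \<ge> 4 \<and>
      ys ! 0 < ys ! 2 \<and>
      ys ! 2 < ys ! 1 \<and>
      ys ! 1 < ys ! 3"
    then have len: "i + 4 \<le> n" using len_ys by arith
    with * have ord: "w (i + 1) < w (i + 3)" "w (i + 3) < w (i + 2)" "w (i + 2) < w (i + 4)"
      by (simp_all add: nth) (simp_all add: numeral_eq_Suc)
    show ?thesis
    proof (rule run_between_imp_atniss_win[OF w, of "i + 2" "i + 3"])
      fix p q assume "i + 2 \<le> p" "p < q" "q \<le> i + 3"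
      then have "p = i + 2" "q = i + 3" by auto
      then show "w q < w p" using ord by simp
    qed (use len ord in \<open>auto simp: numeral_eq_Suc\<close>)
  next
    assume *: "length ys \<ge> 5 \<and>
      ys ! 0 < ys ! 3 \<and>
      ys ! 3 < ys ! 2 \<and>
      ys ! 2 < ys ! 1 \<and>
      ys ! 1 < ys ! 4"
    then have len: "i + 5 \<le> n" using len_ys by arith
    with * have ord: "w (i + 1) < w (i + 4)" "w (i + 4) < w (i + 3)" "w (i + 3) < w (i + 2)"
      "w (i + 2) < w (i + 5)"
      by (simp_all add: nth) (simp_all add: numeral_eq_Suc)
    show ?thesis
    proof (rule run_between_imp_atniss_win[OF w, of "i + 2" "i + 4"])
      fix p q assume "i + 2 \<le> p" "p < q" "q \<le> i + 4"
      then have "p = i + 2 \<and> q = i + 3 \<or> p = i + 2 \<and> q = i + 4 \<or> p = i + 3 \<and> q = i + 4" by auto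
      then show "w q < w p" using ord by auto
    qed (use len ord in \<open>auto simp: numeral_eq_Suc\<close>)
  qed
qed

lemma card_eeta_wins_le: "card (eeta_wins (right_weak_order n)) \<le> num_avoiders n"
proof -
  let ?f = "\<lambda>w. map w [1..<Suc n]"
  have perm: "w permutes {1..n}" and av: "avoids (?f w)" if "w \<in> eeta_wins (right_weak_order n)" for w
  proof -
    show w: "w permutes {1..n}"
      using that by (simp add: eeta_wins_def right_weak_order_def)
    have "eeta_win (weak_ideal n w)"
      using that interval_right_weak_order[of n w] by (simp add: eeta_wins_def)
    then show "avoids (?f w)"
      using not_avoids_imp_atniss_win[OF w] unfolding eeta_win_def by blast
  qed
  have "card (eeta_wins (right_weak_order n)) \<le> card (avoiders {1..n})"
  proof (rule card_inj_on_le[where f = ?f])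
    show "inj_on ?f (eeta_wins (right_weak_order n))"
    proof (rule inj_onI)
      fix u v assume uv: "u \<in> eeta_wins (right_weak_order n)" "v \<in> eeta_wins (right_weak_order n)"
        and "?f u = ?f v"
      then have "\<forall>i\<in>{1..n}. u i = v i" by auto
      then show "u = v"
        using permutes_not_in[OF perm[OF uv(1)]] permutes_not_in[OF perm[OF uv(2)]] by (metis ext)
    qed
    show "?f ` eeta_wins (right_weak_order n) \<subseteq> avoiders {1..n}"
    proof
      fix xs assume "xs \<in> ?f ` eeta_wins (right_weak_order n)"
      then obtain w where w: "w \<in> eeta_wins (right_weak_order n)" and xs: "xs = ?f w" by blast
      have "distinct xs"
        unfolding xs using permutes_inj_on[OF perm[OF w]] by (simp add: distinct_map del: upt_Suc)
      moreover have "set xs = {1..n}"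
        unfolding xs using permutes_image[OF perm[OF w]]
        by (simp add: atLeastLessThanSuc_atLeastAtMost del: upt_Suc)
      ultimately show "xs \<in> avoiders {1..n}" using av[OF w] xs by (simp add: avoiders_def)
    qed
  qed (simp add: finite_avoiders)
  then show ?thesis by (simp add: card_avoiders)
qed

theorem theorem1p4:
  shows "(\<lambda>n. real (card (eeta_wins (right_weak_order n)))) \<in> O(\<lambda>n. 0.95586 ^ n * fact n)"
\<comment> \<open>The constant rewrites the geometric bound, whose exponent counts from 24, as a
  multiple of the \<open>n\<close>-th power.\<close>
proof (rule bigoI[where c = "avoid_prob 24 / 0.95586 ^ 24"])
  show "\<forall>\<^sub>F n in at_top. norm (real (card (eeta_wins (right_weak_order n))))
      \<le> avoid_prob 24 / 0.95586 ^ 24 * norm (0.95586 ^ n * fact n :: real)"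
    using eventually_ge_at_top[of 24]
  proof eventually_elim
    case (elim n)
    then obtain k where n: "n = k + 24" by (metis add.commute le_Suc_ex)
    have "real (card (eeta_wins (right_weak_order n))) \<le> real (num_avoiders n)"
      using card_eeta_wins_le by simp
    also have "\<dots> = avoid_prob n * fact n" by (simp add: avoid_prob_def)
    also have "\<dots> \<le> 0.95586 ^ k * avoid_prob 24 * fact n"
      unfolding n by (intro mult_right_mono avoid_prob_geometric) simp
    also have "\<dots> = avoid_prob 24 / 0.95586 ^ 24 * (0.95586 ^ n * fact n)"
      unfolding n power_add by simp
    finally show ?case by simp
  qed
qed

end
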